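(* Let $\{T_{mn}\}_{m,n\in\mathbb{N}}$ be a double sequence of fuzzy positive linear operators from $C_{2\pi}^{(\mathcal{F})}(\mathbb{R}^2)$ to $C_{2\pi}^{(\mathcal{F})}(\mathbb{R}^2)$, and suppose there is a corresponding double sequence $\{\widetilde{T}_{mn}\}_{m,n\in\mathbb{N}}$ of positive linear operators from $C_{2\pi}(\mathbb{R}^2)$ into itself such that $$\left\{T_{mn}(g;u,v)\right\}_\alpha^{-}=\widetilde{T}_{mn}(g_\alpha^{-};u,v)\quad\text{and}\quad \left\{T_{mn}(g;u,v)\right\}_\alpha^{+}=\widetilde{T}_{mn}(g_\alpha^{+};u,v)$$ for all $m,n$, all $(u,v)\in\mathbb{R}^2$, all $\alpha\in[0,1]$ and all $g\in C_{2\pi}^{(\mathcal{F})}(\mathbb{R}^2)$. For $(u,v)\in\mathbb{R}^2$ let $\varphi_{u,v}\in C_{2\pi}(\mathbb{R}^2)$ be the function $\varphi_{u,v}(x,y)=\sin^2\left(\frac{x-u}{2}\right)+\sin^2\left(\frac{y-v}{2}\right)$, and put $$\gamma_{mn}=\sqrt{\sup_{(u,v)\in\mathbb{R}^2}\left|\widetilde{T}_{mn}(\varphi_{u,v};u,v)\right|}.$$ Then for every $f\in C_{2\pi}^{(\mathcal{F})}(\mathbb{R}^2)$ the following holds: if (i) $\lim_{m,n\to\infty}\Vert\widetilde{T}_{mn}(f_{0})-f_{0}\Vert=0$, where $f_0(u,v)=1$, and (ii) $\lim_{m,n\to\infty}\omega^{\mathcal{F}}(f;\gamma_{mn})=0$,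 then $$\lim_{m,n\to\infty}D^*\left(T_{mn}(f),f\right)=0.$$
   Context: A fuzzy number is a function $\mu:\mathbb{R}\to[0,1]$ that is normal ($\mu(t_0)=1$ for some $t_0$), fuzzy convex ($\mu(\lambda s+(1-\lambda)t)\ge\min\{\mu(s),\mu(t)\}$ for $\lambda\in[0,1]$), upper semicontinuous, and has compact support $\overline{\{t:\mu(t)>0\}}$. $\mathbb{R}_{\mathcal{F}}$ is the set of fuzzy numbers. The $\alpha$-level set is $[\mu]_\alpha=\{t:\mu(t)\ge\alpha\}$ for $0<\alpha\le1$ and $[\mu]_0=\overline{\{t:\mu(t)>0\}}$; it is a compact interval written $[\mu]_\alpha=[\mu_\alpha^-,\mu_\alpha^+]$ (also $\{\mu\}_\alpha^{\mp}$ for the endpoints $\mu_\alpha^{\mp}$). Addition and scalar multiplication by $k\in\mathbb{R}$ are levelwise: $[\mu+\eta]_\alpha=[\mu]_\alpha+[\eta]_\alpha$, $[k\mu]_\alpha=k[\mu]_\alpha$. The partial order is $\mu\preceq\eta$ iff $\mu_\alpha^-\le\eta_\alpha^-$ and $\mu_\alpha^+\le\eta_\alpha^+$ for all $\alpha\in[0,1]$. The metric is $D(\mu,\eta)=\sup_{\alpha\in[0,1]}\max\{|\mu_\alpha^--\eta_\alpha^-|,|\mu_\alpha^+-\eta_\alpha^+|\}$. A function on $\mathbb{R}^2$ is $2\pi$-periodic if $f(u,v)=f(u+2n\pi,v)=f(u,v+2n\pi)$ for all $n\in\mathbb{Z}$ and all $(u,v)$. $C_{2\pi}(\mathbb{R}^2)$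 is the set of $2\pi$-periodic continuous real valued functions on $\mathbb{R}^2$ with the norm $\Vert f\Vert=\sup_{(u,v)\in\mathbb{R}^2}|f(u,v)|$. $C_{2\pi}^{(\mathcal{F})}(\mathbb{R}^2)$ is the set of $2\pi$-periodic functions $f:\mathbb{R}^2\to\mathbb{R}_{\mathcal{F}}$ that are continuous with respect to $D$, with the metric $D^*(f,g)=\sup_{(u,v)\in\mathbb{R}^2}D(f(u,v),g(u,v))$. For such $f$, $f_\alpha^{\mp}$ denote the real valued endpoint functions given by $[f(u,v)]_\alpha=[f_\alpha^-(u,v),f_\alpha^+(u,v)]$; they belong to $C_{2\pi}(\mathbb{R}^2)$. For $f\in C_{2\pi}^{(\mathcal{F})}(\mathbb{R}^2)$ and $\delta\ge0$, the fuzzy modulus of continuity is $\omega^{\mathcal{F}}(f;\delta)=\sup\{D(f(u,v),f(x,y)):(u,v),(x,y)\in\mathbb{R}^2,\ \sqrt{(u-x)^2+(v-y)^2}\le\delta\}$. For an operator $T$, $T(f;u,v)$ denotes the value of $T(f)$ at $(u,v)$. An operator $T:C_{2\pi}^{(\mathcal{F})}(\mathbb{R}^2)\to C_{2\pi}^{(\mathcal{F})}(\mathbb{R}^2)$ is fuzzy linear if $T(k_1f_1+k_2f_2;u,v)=k_1T(f_1;u,v)+k_2T(f_2;u,v)$ for all $k_1,k_2\in\mathbb{R}$, all $f_1,f_2$ and all $(u,v)$; it is fuzzy positive linear if it is fuzzy linear and, whenever $f(u,v)\preceq g(u,v)$ for all $(u,v)\in\mathbb{R}^2$, one has $T(f;u,v)\preceq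 T(g;u,v)$ for all $(u,v)\in\mathbb{R}^2$. A positive linear operator on $C_{2\pi}(\mathbb{R}^2)$ is a linear operator mapping nonnegative functions to nonnegative functions. Limits of double sequences are in the Pringsheim sense: $\lim_{m,n\to\infty}x_{mn}=L$ means that for every $\varepsilon>0$ there is $N$ with $|x_{mn}-L|<\varepsilon$ for all $m,n\ge N$. *)

theory Defs
  imports "HOL-Analysis.Analysis"
begin

section \<open>Fuzzy numbers\<close>

definition usc :: "(real \<Rightarrow> real) \<Rightarrow> bool"
  where "usc \<mu> \<longleftrightarrow> (\<forall>t. \<forall>e>0. \<forall>\<^sub>F s in nhds t. \<mu> s < \<mu> t + e)"

definition is_fuzzy_number :: "(real \<Rightarrow> real) \<Rightarrow> bool"
  where "is_fuzzy_number \<mu> \<longleftrightarrow>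
    (\<forall>t. 0 \<le> \<mu> t \<and> \<mu> t \<le> 1) \<and>
    (\<exists>t. \<mu> t = 1) \<and>
    (\<forall>s t. \<forall>l\<in>{0..1}. \<mu> (l * s + (1 - l) * t) \<ge> min (\<mu> s) (\<mu> t)) \<and>
    usc \<mu> \<and>
    compact (closure {t. \<mu> t > 0})"

lemma usc_closed_superlevel:
  assumes "usc \<mu>" shows "closed {t. a \<le> \<mu> t}"
proof -
  have "open {t. \<mu> t < a}"
  proof (subst open_subopen, intro ballI)
    fix t assume "t \<in> {t. \<mu> t < a}"
    then have "\<forall>\<^sub>F s in nhds t. \<mu> s < \<mu> t + (a - \<mu> t)"
      using assms unfolding usc_def by (metis diff_gt_0_iff_gt mem_Collect_eq)
    then show "\<exists>T. open T \<and> t \<in> T \<and> T \<subseteq> {t. \<mu> t < a}"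
      by (auto simp: eventually_nhds)
  qed
  moreover have "{t. a \<le> \<mu> t} = - {t. \<mu> t < a}" by auto
  ultimately show ?thesis by (simp add: closed_def)
qed

lemma is_fuzzy_numberI:
  assumes r: "\<And>t. 0 \<le> \<nu> t \<and> \<nu> t \<le> 1"
    and A: "\<And>\<alpha>. 0 < \<alpha> \<Longrightarrow> \<alpha> \<le> 1 \<Longrightarrow> closed {t. \<alpha> \<le> \<nu> t} \<and> convex {t. \<alpha> \<le> \<nu> t}"
    and 1: "{t. 1 \<le> \<nu> t} \<noteq> {}"
    and 0: "compact (closure {t. 0 < \<nu> t})"
  shows "is_fuzzy_number \<nu>"
  unfolding is_fuzzy_number_def
proof (intro conjI allI ballI)
  fix t show "0 \<le> \<nu> t" "\<nu> t \<le> 1" using r by auto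
next
  show "\<exists>t. \<nu> t = 1" using 1 r by (metis (mono_tags) antisym empty_Collect_eq)
next
  fix s t and l :: real assume l: "l \<in> {0..1}"
  let ?a = "min (\<nu> s) (\<nu> t)"
  show "?a \<le> \<nu> (l * s + (1 - l) * t)"
  proof (cases "?a > 0")
    case True
    have "?a \<le> 1" using r[of s] by auto
    with True A have "convex {t. ?a \<le> \<nu> t}" by blast
    from convexD[OF this, of s t l "1 - l"] l show ?thesis by auto
  next
    case False then show ?thesis using r by (metis not_le order_trans)
  qed
next
  show "usc \<nu>" unfolding usc_def
  proof (intro allI impI)
    fix t and e :: real assume e: "e > 0"
    show "\<forall>\<^sub>F s in nhds t. \<nu> s < \<nu> t + e"
    proof (cases "\<nu> t + e \<le> 1")
      case True
      have "closed {s. \<nu> t + e \<le> \<nu> s}" using A[of "\<nu> t + e"] True e r[of t] by auto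
      then have "open (- {s. \<nu> t + e \<le> \<nu> s})" by (rule open_Compl)
      moreover have "t \<in> - {s. \<nu> t + e \<le> \<nu> s}" using e by auto
      ultimately have "\<forall>\<^sub>F s in nhds t. s \<in> - {s. \<nu> t + e \<le> \<nu> s}"
        by (rule eventually_nhds_in_open)
      then show ?thesis by (rule eventually_mono) auto
    next
      case False
      then have "\<nu> s < \<nu> t + e" for s using r[of s] by auto
      then show ?thesis by simp
    qed
  qed
qed (fact 0)

lemma is_fuzzy_number_indicator: "is_fuzzy_number (indicat_real {a})"
proof (rule is_fuzzy_numberI)
  fix \<alpha> :: real assume "0 < \<alpha>" "\<alpha> \<le> 1"
  then have "{t. \<alpha> \<le> indicat_real {a} t} = {a}" by (auto simp: indicator_def)
  then show "closed {t. \<alpha> \<le> indicat_real {a} t} \<and> convex {t. \<alpha> \<le> indicat_real {a} t}" by simp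
next
  have "{t. 0 < indicat_real {a} t} = {a}" by (auto simp: indicator_def)
  then show "compact (closure {t. 0 < indicat_real {a} t})" by simp
  show "{t. 1 \<le> indicat_real {a} t} \<noteq> {}" by (auto intro!: exI[of _ a])
qed (auto simp: indicator_def)

typedef fuzzy = "{\<mu>. is_fuzzy_number \<mu>}"
  morphisms mem Abs_fuzzy
  using is_fuzzy_number_indicator by blast

lemma is_fuzzy_number_mem: "is_fuzzy_number (mem \<mu>)"
  using mem by auto

lemma mem_range: "0 \<le> mem \<mu> t" "mem \<mu> t \<le> 1"
  using is_fuzzy_number_mem[of \<mu>] by (auto simp: is_fuzzy_number_def)


subsection \<open>Level sets\<close>

definition level :: "fuzzy \<Rightarrow> real \<Rightarrow> real set"
  where "level \<mu> \<alpha> = (if \<alpha> = 0 then closure {t. mem \<mu> t > 0} else {t. mem \<mu> t \<ge> \<alpha>})"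

definition lower_end :: "fuzzy \<Rightarrow> real \<Rightarrow> real"
  where "lower_end \<mu> \<alpha> = Inf (level \<mu> \<alpha>)"

definition upper_end :: "fuzzy \<Rightarrow> real \<Rightarrow> real"
  where "upper_end \<mu> \<alpha> = Sup (level \<mu> \<alpha>)"

lemma level_antimono:
  assumes "0 \<le> \<alpha>" "\<alpha> \<le> \<beta>"
  shows "level \<mu> \<beta> \<subseteq> level \<mu> \<alpha>"
proof (cases "\<alpha> = 0")
  case True
  have "{t. mem \<mu> t \<ge> \<beta>} \<subseteq> closure {t. mem \<mu> t > 0}" if "\<beta> \<noteq> 0"
    using that assms closure_subset by fastforce
  then show ?thesis using True by (auto simp: level_def)
qed (use assms in \<open>auto simp: level_def\<close>)

lemma level_nonempty:
  assumes "\<alpha> \<in> {0..1}" shows "level \<mu> \<alpha> \<noteq> {}"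
proof -
  obtain t where "mem \<mu> t = 1"
    using is_fuzzy_number_mem[of \<mu>] by (auto simp: is_fuzzy_number_def)
  then have "t \<in> level \<mu> 1" by (simp add: level_def)
  then show ?thesis using level_antimono[of \<alpha> 1 \<mu>] assms by auto
qed

lemma compact_level:
  assumes "\<alpha> \<in> {0..1}" shows "compact (level \<mu> \<alpha>)"
proof -
  have 0: "compact (level \<mu> 0)" and u: "usc (mem \<mu>)"
    using is_fuzzy_number_mem[of \<mu>] by (auto simp: is_fuzzy_number_def level_def)
  have "closed (level \<mu> \<alpha>)"
    using usc_closed_superlevel[OF u] by (simp add: level_def)
  then show ?thesis
    using level_antimono[of 0 \<alpha> \<mu>] assms 0
    by (metis atLeastAtMost_iff closed_Int_compact inf.orderE order_refl)
qed

lemma convex_level: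
  shows "convex (level \<mu> \<alpha>)"
proof -
  have c: "min (mem \<mu> s) (mem \<mu> t) \<le> mem \<mu> (l * s + (1 - l) * t)" if "0 \<le> l" "l \<le> 1" for s t l
    using is_fuzzy_number_mem[of \<mu>] that by (auto simp: is_fuzzy_number_def)
  have c': "min (mem \<mu> s) (mem \<mu> t) \<le> mem \<mu> (u * s + v * t)"
    if "0 \<le> u" "0 \<le> v" "u + v = 1" for s t u v
  proof -
    have v: "v = 1 - u" using that by simp
    show ?thesis unfolding v using c[of u s t] that by simp
  qed
  have "convex {t. mem \<mu> t > 0}" "convex {t. mem \<mu> t \<ge> \<alpha>}"
    by (auto simp: convex_def intro: less_le_trans[OF _ c'] order_trans[OF _ c'])
  then show ?thesis by (auto simp: level_def intro: convex_closure)
qed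

lemma lower_end_in: "\<alpha> \<in> {0..1} \<Longrightarrow> lower_end \<mu> \<alpha> \<in> level \<mu> \<alpha>"
  unfolding lower_end_def
  by (simp add: closed_contains_Inf compact_imp_bounded compact_imp_closed bounded_imp_bdd_below
      compact_level level_nonempty)

lemma upper_end_in: "\<alpha> \<in> {0..1} \<Longrightarrow> upper_end \<mu> \<alpha> \<in> level \<mu> \<alpha>"
  unfolding upper_end_def
  by (simp add: closed_contains_Sup compact_imp_bounded compact_imp_closed bounded_imp_bdd_above
      compact_level level_nonempty)

lemma level_eq_interval:
  assumes "\<alpha> \<in> {0..1}"
  shows "level \<mu> \<alpha> = {lower_end \<mu> \<alpha>..upper_end \<mu> \<alpha>}"
proof
  have "bounded (level \<mu> \<alpha>)" using compact_level[OF assms] by (rule compact_imp_bounded)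
  then show "level \<mu> \<alpha> \<subseteq> {lower_end \<mu> \<alpha>..upper_end \<mu> \<alpha>}"
    by (auto simp: lower_end_def upper_end_def
        intro!: cInf_lower cSup_upper bounded_imp_bdd_below bounded_imp_bdd_above)
  show "{lower_end \<mu> \<alpha>..upper_end \<mu> \<alpha>} \<subseteq> level \<mu> \<alpha>"
    using convex_level[of \<mu> \<alpha>] lower_end_in[OF assms] upper_end_in[OF assms]
    by (metis closed_segment_subset closed_segment_eq_real_ivl atLeastatMost_empty empty_subsetI
        not_le)
qed

lemma fuzzy_level_eqI:
  assumes "\<And>\<alpha>. \<alpha> \<in> {0..1} \<Longrightarrow> level \<mu> \<alpha> = level \<eta> \<alpha>"
  shows "\<mu> = \<eta>"
proof -
  have *: "mem \<mu> t \<le> mem \<eta> t" if "\<And>\<alpha>. \<alpha> \<in> {0..1} \<Longrightarrow> level \<mu> \<alpha> = level \<eta> \<alpha>" for \<mu> \<eta> t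
  proof (cases "mem \<mu> t = 0")
    case False
    then have "t \<in> level \<mu> (mem \<mu> t)" by (simp add: level_def)
    then have "t \<in> level \<eta> (mem \<mu> t)" using that[of "mem \<mu> t"] mem_range by simp
    then show ?thesis using False by (simp add: level_def)
  qed (simp add: mem_range)
  have "mem \<mu> = mem \<eta>" using *[of \<mu> \<eta>] *[of \<eta> \<mu>] assms by (metis antisym ext)
  then show ?thesis by (simp add: mem_inject)
qed


subsection \<open>Levelwise addition and scalar multiplication\<close>

instantiation fuzzy :: "{plus, scaleR}"
begin

text \<open>Existence and uniqueness for both descriptions are established in \<open>level_plus\<close> and
  \<open>level_scaleR\<close> below.\<close>

definition plus_fuzzy :: "fuzzy \<Rightarrow> fuzzy \<Rightarrow> fuzzy"
  where "\<mu> + \<eta> = (THE \<nu>. \<forall>\<alpha>\<in>{0..1}. level \<nu> \<alpha> = {s + t | s t. s \<in> level \<mu> \<alpha> \<and> t \<in> level \<eta> \<alpha>})"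

definition scaleR_fuzzy :: "real \<Rightarrow> fuzzy \<Rightarrow> fuzzy"
  where "k *\<^sub>R \<mu> = (THE \<nu>. \<forall>\<alpha>\<in>{0..1}. level \<nu> \<alpha> = {k * t | t. t \<in> level \<mu> \<alpha>})"

instance ..

end

lemma fuzzy_from_levels:
  assumes r: "\<And>t. 0 \<le> \<nu> t \<and> \<nu> t \<le> 1"
    and lev: "\<And>\<alpha>. 0 < \<alpha> \<Longrightarrow> \<alpha> \<le> 1 \<Longrightarrow> {t. \<alpha> \<le> \<nu> t} = A \<alpha>"
    and lev0: "closure {t. 0 < \<nu> t} = A 0"
    and A: "\<And>\<alpha>. \<alpha> \<in> {0..1} \<Longrightarrow> compact (A \<alpha>) \<and> convex (A \<alpha>) \<and> A \<alpha> \<noteq> {}"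
  shows "\<exists>!\<mu>. \<forall>\<alpha>\<in>{0..1}. level \<mu> \<alpha> = A \<alpha>"
proof -
  have "is_fuzzy_number \<nu>"
    by (rule is_fuzzy_numberI) (use r lev lev0 A in \<open>auto simp: compact_imp_closed\<close>)
  then have m: "mem (Abs_fuzzy \<nu>) = \<nu>" by (simp add: Abs_fuzzy_inverse)
  have "\<forall>\<alpha>\<in>{0..1}. level (Abs_fuzzy \<nu>) \<alpha> = A \<alpha>"
    unfolding level_def m using lev lev0 by auto
  then show ?thesis
    by (intro ex1I[of _ "Abs_fuzzy \<nu>"]) (auto intro!: fuzzy_level_eqI)
qed

lemma level_plus:
  assumes "\<alpha> \<in> {0..1}"
  shows "level (\<mu> + \<eta>) \<alpha> = {s + t | s t. s \<in> level \<mu> \<alpha> \<and> t \<in> level \<eta> \<alpha>}"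
proof -
  define A where "A \<alpha> = {s + t | s t. s \<in> level \<mu> \<alpha> \<and> t \<in> level \<eta> \<alpha>}" for \<alpha>
  define \<nu> where "\<nu> t = (SUP s. min (mem \<mu> s) (mem \<eta> (t - s)))" for t
  have bdd: "bdd_above (range (\<lambda>s. min (mem \<mu> s) (mem \<eta> (t - s))))" for t
    by (intro bdd_aboveI[of _ 1]) (auto simp: min_le_iff_disj mem_range)
  have le\<nu>: "min (mem \<mu> s) (mem \<eta> (t - s)) \<le> \<nu> t" for s t
    unfolding \<nu>_def by (rule cSUP_upper[OF _ bdd]) simp
  have r: "0 \<le> \<nu> t \<and> \<nu> t \<le> 1" for t
  proof
    show "0 \<le> \<nu> t" using le\<nu>[of 0 t] mem_range(1)[of \<mu> 0] mem_range(1)[of \<eta> "t - 0"] by linarith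
    show "\<nu> t \<le> 1" unfolding \<nu>_def by (rule cSUP_least) (auto simp: min_le_iff_disj mem_range)
  qed
  have lev: "{t. \<alpha> \<le> \<nu> t} = A \<alpha>" if a: "0 < \<alpha>" "\<alpha> \<le> 1" for \<alpha>
  proof
    show "A \<alpha> \<subseteq> {t. \<alpha> \<le> \<nu> t}"
    proof (clarsimp simp: A_def level_def a less_imp_neq[symmetric] split: if_splits)
      fix s t assume "\<alpha> \<le> mem \<mu> s" "\<alpha> \<le> mem \<eta> t"
      then show "\<alpha> \<le> \<nu> (s + t)" using le\<nu>[of s "s + t"] by auto
    qed
    show "{t. \<alpha> \<le> \<nu> t} \<subseteq> A \<alpha>"
    proof
      fix t assume "t \<in> {t. \<alpha> \<le> \<nu> t}"
      then have t: "\<alpha> \<le> \<nu> t" by simp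
      define b where "b n = \<alpha> * (1 - inverse (real n + 2))" for n :: nat
      have b: "0 < b n" "b n < \<alpha>" "b n \<in> {0..1}" for n
      proof -
        have i: "inverse (real n + 2) < 1" "inverse (real n + 2) > 0" by (auto simp: field_simps)
        then show "0 < b n" "b n < \<alpha>" using a by (auto simp: b_def)
        then show "b n \<in> {0..1}" using a by auto
      qed
      have bm: "b m \<le> b n" if "m \<le> n" for m n
        unfolding b_def using that a by (auto intro!: mult_left_mono le_imp_inverse_le)
      define K where "K n = level \<mu> (b n) \<inter> {s. t - s \<in> level \<eta> (b n)}" for n
      have Keq: "K n = {s. b n \<le> min (mem \<mu> s) (mem \<eta> (t - s))}" for n
        using b(1)[of n] by (auto simp: K_def level_def)
      have "\<Inter>(range K) \<noteq> {}"
      proof (rule compact_nest)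
        fix n
        have "closed (level \<eta> (b n))" using compact_level[OF b(3)] compact_imp_closed by blast
        then have "closed ((\<lambda>s. t - s) -` level \<eta> (b n))"
          by (intro continuous_closed_vimage continuous_intros) auto
        then have "closed {s. t - s \<in> level \<eta> (b n)}" by (simp add: vimage_def)
        then show "compact (K n)" unfolding K_def by (intro compact_Int_closed compact_level b(3))
        have "b n < \<nu> t" using b(2)[of n] t by simp
        then obtain s where "b n < min (mem \<mu> s) (mem \<eta> (t - s))"
          unfolding \<nu>_def by (subst (asm) less_cSUP_iff[OF _ bdd]) auto
        then show "K n \<noteq> {}" unfolding Keq by (auto intro!: exI[of _ s])
      next
        fix m n :: nat assume "m \<le> n"
        then show "K n \<subseteq> K m" using bm[of m n] by (auto simp: Keq)
      qed
      then obtain s where s: "\<And>n. s \<in> K n" by auto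
      have "b \<longlonglongrightarrow> \<alpha>"
      proof -
        have "(\<lambda>n. \<alpha> * (1 - inverse (real (n + 2)))) \<longlonglongrightarrow> \<alpha> * (1 - 0)"
          by (intro tendsto_intros LIMSEQ_ignore_initial_segment[OF lim_inverse_n])
        then show ?thesis by (simp add: b_def [abs_def] add.commute)
      qed
      then have "\<alpha> \<le> min (mem \<mu> s) (mem \<eta> (t - s))"
        by (rule LIMSEQ_le_const2) (use s Keq in auto)
      then have "s \<in> level \<mu> \<alpha>" "t - s \<in> level \<eta> \<alpha>" using a by (auto simp: level_def)
      then show "t \<in> A \<alpha>" unfolding A_def by (intro CollectI exI[of _ s] exI[of _ "t - s"]) simp
    qed
  qed
  have A: "compact (A \<alpha>) \<and> convex (A \<alpha>) \<and> A \<alpha> \<noteq> {}" if "\<alpha> \<in> {0..1}" for \<alpha>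
  proof (intro conjI)
    show "compact (A \<alpha>)"
      unfolding A_def by (intro compact_sums compact_level that)
    have "A \<alpha> = (\<Union>x\<in>level \<mu> \<alpha>. \<Union>y\<in>level \<eta> \<alpha>. {x + y})" by (auto simp: A_def)
    then show "convex (A \<alpha>)" using convex_sums[OF convex_level convex_level] by simp
    show "A \<alpha> \<noteq> {}"
      using level_nonempty[OF that, of \<mu>] level_nonempty[OF that, of \<eta>] by (auto simp: A_def)
  qed
  have lev0: "closure {t. 0 < \<nu> t} = A 0"
  proof
    let ?P = "{t. 0 < mem \<mu> t}" and ?Q = "{t. 0 < mem \<eta> t}"
    have eq: "{t. 0 < \<nu> t} = ?P + ?Q"
    proof (rule set_eqI, unfold set_plus_def mem_Collect_eq, rule iffI)
      fix t assume "0 < \<nu> t"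
      then obtain s where "0 < min (mem \<mu> s) (mem \<eta> (t - s))"
        unfolding \<nu>_def by (subst (asm) less_cSUP_iff[OF _ bdd]) auto
      then show "\<exists>a\<in>?P. \<exists>b\<in>?Q. t = a + b"
        by (intro bexI[of _ s] bexI[of _ "t - s"]) auto
    next
      fix t assume "\<exists>a\<in>?P. \<exists>b\<in>?Q. t = a + b"
      then obtain a b where "0 < mem \<mu> a" "0 < mem \<eta> b" "t = a + b" by auto
      then show "0 < \<nu> t" using le\<nu>[of a t] by auto
    qed
    have A0: "A 0 = closure ?P + closure ?Q" by (auto simp: A_def level_def set_plus_def)
    show "A 0 \<subseteq> closure {t. 0 < \<nu> t}" unfolding eq A0 by (rule closure_sum)
    show "closure {t. 0 < \<nu> t} \<subseteq> A 0"
    proof (rule closure_minimal)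
      show "{t. 0 < \<nu> t} \<subseteq> A 0" unfolding eq A0 by (intro set_plus_mono2 closure_subset)
      show "closed (A 0)" using A[of 0] by (simp add: compact_imp_closed)
    qed
  qed
  have "\<exists>!\<mu>. \<forall>\<alpha>\<in>{0..1}. level \<mu> \<alpha> = A \<alpha>"
    by (rule fuzzy_from_levels[OF r lev lev0 A])
  from theI'[OF this] have "\<forall>\<alpha>\<in>{0..1}. level (\<mu> + \<eta>) \<alpha> = A \<alpha>"
    by (simp add: plus_fuzzy_def A_def)
  then show ?thesis using assms by (simp add: A_def)
qed

lemma level_scaleR:
  assumes "\<alpha> \<in> {0..1}"
  shows "level (k *\<^sub>R \<mu>) \<alpha> = {k * t | t. t \<in> level \<mu> \<alpha>}"
proof -
  define A where "A \<alpha> = {k * t | t. t \<in> level \<mu> \<alpha>}" for \<alpha>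
  have Aim: "A \<alpha> = (*) k ` level \<mu> \<alpha>" for \<alpha> by (auto simp: A_def)
  have A: "compact (A \<alpha>) \<and> convex (A \<alpha>) \<and> A \<alpha> \<noteq> {}" if "\<alpha> \<in> {0..1}" for \<alpha>
    using compact_scaling[OF compact_level[OF that], of k \<mu>] convex_scaling[OF convex_level, of k \<mu> \<alpha>]
      level_nonempty[OF that] by (auto simp: Aim)
  have "\<exists>!\<nu>. \<forall>\<alpha>\<in>{0..1}. level \<nu> \<alpha> = A \<alpha>"
  proof (cases "k = 0")
    case True
    have A0: "A \<alpha> = {0}" if "\<alpha> \<in> {0..1}" for \<alpha>
      using level_nonempty[OF that] True by (auto simp: A_def)
    have "{t. 0 < indicat_real {0::real} t} = {0}" by (auto simp: indicator_def)
    then have "closure {t. 0 < indicat_real {0} t} = A 0" by (simp add: A0)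
    moreover have "{t. \<alpha> \<le> indicat_real {0} t} = A \<alpha>" if "0 < \<alpha>" "\<alpha> \<le> 1" for \<alpha>
      using that A0[of \<alpha>] by (auto simp: indicator_def split: if_splits)
    ultimately show ?thesis
      by (intro fuzzy_from_levels[where \<nu> = "indicat_real {0}"] A) simp_all
  next
    case False
    have im: "{t. B \<le> mem \<mu> (t / k)} = (*) k ` {t. B \<le> mem \<mu> t}"
      "{t. B < mem \<mu> (t / k)} = (*) k ` {t. B < mem \<mu> t}" for B
      using False by (auto simp: image_iff intro!: exI[of _ "_ / k"])
    show ?thesis
    proof (rule fuzzy_from_levels[where \<nu> = "\<lambda>t. mem \<mu> (t / k)"])
      show "0 \<le> mem \<mu> (t / k) \<and> mem \<mu> (t / k) \<le> 1" for t by (simp add: mem_range)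
      show "{t. \<alpha> \<le> mem \<mu> (t / k)} = A \<alpha>" if "0 < \<alpha>" "\<alpha> \<le> 1" for \<alpha>
        using that by (simp add: im Aim level_def)
      show "closure {t. 0 < mem \<mu> (t / k)} = A 0"
        using closure_scaleR[of k "{t. 0 < mem \<mu> t}"] by (simp add: im Aim level_def)
    qed (rule A)
  qed
  from theI'[OF this] have "\<forall>\<alpha>\<in>{0..1}. level (k *\<^sub>R \<mu>) \<alpha> = A \<alpha>"
    by (simp add: scaleR_fuzzy_def A_def)
  then show ?thesis using assms by (simp add: A_def)
qed


subsection \<open>Order and metric\<close>

lemma fuzzy_ends_eqI:
  assumes "\<And>\<alpha>. \<alpha> \<in> {0..1} \<Longrightarrow> lower_end \<mu> \<alpha> = lower_end \<eta> \<alpha> \<and> upper_end \<mu> \<alpha> = upper_end \<eta> \<alpha>"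
  shows "\<mu> = \<eta>"
  using assms by (intro fuzzy_level_eqI) (auto simp: level_eq_interval)

instantiation fuzzy :: order
begin

definition less_eq_fuzzy :: "fuzzy \<Rightarrow> fuzzy \<Rightarrow> bool"
  where "\<mu> \<le> \<eta> \<longleftrightarrow> (\<forall>\<alpha>\<in>{0..1}. lower_end \<mu> \<alpha> \<le> lower_end \<eta> \<alpha> \<and> upper_end \<mu> \<alpha> \<le> upper_end \<eta> \<alpha>)"

definition less_fuzzy :: "fuzzy \<Rightarrow> fuzzy \<Rightarrow> bool"
  where "\<mu> < \<eta> \<longleftrightarrow> \<mu> \<le> \<eta> \<and> \<not> \<eta> \<le> (\<mu> :: fuzzy)"

instance
proof
  fix x y z :: fuzzy
  show "x \<le> y \<Longrightarrow> y \<le> z \<Longrightarrow> x \<le> z" unfolding less_eq_fuzzy_def by (meson order_trans)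
  show "x \<le> y \<Longrightarrow> y \<le> x \<Longrightarrow> x = y"
    by (rule fuzzy_ends_eqI) (auto simp: less_eq_fuzzy_def intro: antisym)
qed (auto simp: less_fuzzy_def less_eq_fuzzy_def)

end

definition end_diff :: "fuzzy \<Rightarrow> fuzzy \<Rightarrow> real \<Rightarrow> real"
  where "end_diff \<mu> \<eta> \<alpha> =
    max \<bar>lower_end \<mu> \<alpha> - lower_end \<eta> \<alpha>\<bar> \<bar>upper_end \<mu> \<alpha> - upper_end \<eta> \<alpha>\<bar>"

lemma bdd_above_end_diff: "bdd_above (end_diff \<mu> \<eta> ` {0..1})"
proof -
  have "\<exists>B. \<forall>\<alpha>\<in>{0..1}. \<bar>lower_end \<mu> \<alpha>\<bar> \<le> B \<and> \<bar>upper_end \<mu> \<alpha>\<bar> \<le> B" for \<mu>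
  proof -
    obtain B where B: "\<And>t. t \<in> level \<mu> 0 \<Longrightarrow> \<bar>t\<bar> \<le> B"
      using compact_imp_bounded[OF compact_level[of 0 \<mu>]] by (auto simp: bounded_iff)
    show ?thesis
      using level_antimono[of 0 _ \<mu>] lower_end_in upper_end_in
      by (intro exI[of _ B] ballI conjI B) (meson atLeastAtMost_iff order_refl subsetD)+
  qed
  then obtain B C where
    "\<forall>\<alpha>\<in>{0..1}. \<bar>lower_end \<mu> \<alpha>\<bar> \<le> B \<and> \<bar>upper_end \<mu> \<alpha>\<bar> \<le> B"
    "\<forall>\<alpha>\<in>{0..1}. \<bar>lower_end \<eta> \<alpha>\<bar> \<le> C \<and> \<bar>upper_end \<eta> \<alpha>\<bar> \<le> C" by metis
  then show ?thesis
    by (intro bdd_aboveI[of _ "B + C"]) (fastforce simp: end_diff_def)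
qed

instantiation fuzzy :: metric_space
begin

definition dist_fuzzy :: "fuzzy \<Rightarrow> fuzzy \<Rightarrow> real"
  where "dist \<mu> \<eta> = (SUP \<alpha>\<in>{0..1}.
    max \<bar>lower_end \<mu> \<alpha> - lower_end \<eta> \<alpha>\<bar> \<bar>upper_end \<mu> \<alpha> - upper_end \<eta> \<alpha>\<bar>)"

definition uniformity_fuzzy :: "(fuzzy \<times> fuzzy) filter"
  where "uniformity_fuzzy = (INF e\<in>{0 <..}. principal {(x, y). dist x y < e})"

definition open_fuzzy :: "fuzzy set \<Rightarrow> bool"
  where "open_fuzzy S = (\<forall>x\<in>S. \<forall>\<^sub>F (x', y) in uniformity. x' = x \<longrightarrow> y \<in> S)"

instance
proof
  have d: "dist \<mu> \<eta> = (SUP \<alpha>\<in>{0..1}. end_diff \<mu> \<eta> \<alpha>)" for \<mu> \<eta>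
    by (simp add: dist_fuzzy_def end_diff_def)
  have le: "end_diff \<mu> \<eta> \<alpha> \<le> dist \<mu> \<eta>" if "\<alpha> \<in> {0..1}" for \<mu> \<eta> \<alpha>
    unfolding d using that by (rule cSUP_upper[OF _ bdd_above_end_diff])
  have least: "dist \<mu> \<eta> \<le> M" if "\<And>\<alpha>. \<alpha> \<in> {0..1} \<Longrightarrow> end_diff \<mu> \<eta> \<alpha> \<le> M" for \<mu> \<eta> M
    unfolding d using that by (intro cSUP_least) auto
  fix x y z :: fuzzy
  show "(dist x y = 0) = (x = y)"
  proof
    assume "dist x y = 0"
    then have "end_diff x y \<alpha> \<le> 0" if "\<alpha> \<in> {0..1}" for \<alpha> using le[OF that, of x y] by simp
    then show "x = y" by (intro fuzzy_ends_eqI) (auto simp: end_diff_def)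
  next
    assume "x = y"
    then show "dist x y = 0" by (simp add: dist_fuzzy_def)
  qed
  show "dist x y \<le> dist x z + dist y z"
  proof (rule least)
    fix \<alpha> :: real assume a: "\<alpha> \<in> {0..1}"
    have "end_diff x y \<alpha> \<le> end_diff x z \<alpha> + end_diff y z \<alpha>"
      unfolding end_diff_def by linarith
    then show "end_diff x y \<alpha> \<le> dist x z + dist y z" using le[OF a, of x z] le[OF a, of y z] by linarith
  qed
qed (simp_all add: uniformity_fuzzy_def open_fuzzy_def)

end


section \<open>Periodic functions and operators\<close>

definition periodic_2pi :: "(real \<times> real \<Rightarrow> 'a) \<Rightarrow> bool"
  where "periodic_2pi f \<longleftrightarrow> (\<forall>u v. \<forall>n::int.
    f (u, v) = f (u + 2 * of_int n * pi, v) \<and> f (u, v) = f (u, v + 2 * of_int n * pi))"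

definition C2pi :: "(real \<times> real \<Rightarrow> real) set"
  where "C2pi = {f. periodic_2pi f \<and> continuous_on UNIV f}"

definition C2pi_F :: "(real \<times> real \<Rightarrow> fuzzy) set"
  where "C2pi_F = {f. periodic_2pi f \<and> continuous_on UNIV f}"

text \<open>The suprema below are real-valued \<open>Sup\<close>, which is unspecified on unbounded sets;
  continuous doubly periodic functions are bounded, so this does not arise on the spaces above.\<close>

definition sup_norm :: "(real \<times> real \<Rightarrow> real) \<Rightarrow> real"
  where "sup_norm f = (SUP p. \<bar>f p\<bar>)"

definition Dstar :: "(real \<times> real \<Rightarrow> fuzzy) \<Rightarrow> (real \<times> real \<Rightarrow> fuzzy) \<Rightarrow> real"
  where "Dstar f g = (SUP p. dist (f p) (g p))"

definition fuzzy_modulus :: "(real \<times> real \<Rightarrow> fuzzy) \<Rightarrow> real \<Rightarrow> real"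
  where "fuzzy_modulus f \<delta> =
    Sup {dist (f (u, v)) (f (x, y)) | u v x y. sqrt ((u - x)\<^sup>2 + (v - y)\<^sup>2) \<le> \<delta>}"

text \<open>Operators are total functions; only their values on the function space are constrained.\<close>

definition fuzzy_linear :: "((real \<times> real \<Rightarrow> fuzzy) \<Rightarrow> (real \<times> real \<Rightarrow> fuzzy)) \<Rightarrow> bool"
  where "fuzzy_linear T \<longleftrightarrow> T \<in> C2pi_F \<rightarrow> C2pi_F \<and>
    (\<forall>k1 k2. \<forall>f1\<in>C2pi_F. \<forall>f2\<in>C2pi_F. \<forall>p.
      T (\<lambda>q. k1 *\<^sub>R f1 q + k2 *\<^sub>R f2 q) p = k1 *\<^sub>R T f1 p + k2 *\<^sub>R T f2 p)"

definition fuzzy_positive_linear :: "((real \<times> real \<Rightarrow> fuzzy) \<Rightarrow> (real \<times> real \<Rightarrow> fuzzy)) \<Rightarrow> bool"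
  where "fuzzy_positive_linear T \<longleftrightarrow> fuzzy_linear T \<and>
    (\<forall>f\<in>C2pi_F. \<forall>g\<in>C2pi_F. (\<forall>p. f p \<le> g p) \<longrightarrow> (\<forall>p. T f p \<le> T g p))"

definition positive_linear :: "((real \<times> real \<Rightarrow> real) \<Rightarrow> (real \<times> real \<Rightarrow> real)) \<Rightarrow> bool"
  where "positive_linear T \<longleftrightarrow> T \<in> C2pi \<rightarrow> C2pi \<and>
    (\<forall>k1 k2. \<forall>f1\<in>C2pi. \<forall>f2\<in>C2pi. \<forall>p.
      T (\<lambda>q. k1 * f1 q + k2 * f2 q) p = k1 * T f1 p + k2 * T f2 p) \<and>
    (\<forall>f\<in>C2pi. (\<forall>p. 0 \<le> f p) \<longrightarrow> (\<forall>p. 0 \<le> T f p))"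

definition phi :: "real \<Rightarrow> real \<Rightarrow> real \<times> real \<Rightarrow> real"
  where "phi u v = (\<lambda>(x, y). (sin ((x - u) / 2))\<^sup>2 + (sin ((y - v) / 2))\<^sup>2)"

definition pringsheim_lim :: "(nat \<Rightarrow> nat \<Rightarrow> real) \<Rightarrow> real \<Rightarrow> bool"
  where "pringsheim_lim x L \<longleftrightarrow> (\<forall>e>0. \<exists>N. \<forall>m\<ge>N. \<forall>n\<ge>N. \<bar>x m n - L\<bar> < e)"

end

theory Submission
  imports Defs
begin

text \<open>A value \<open>f q\<close> at an arbitrary point can be replaced by the value at a \<open>2 * pi\<close>-translate of
  \<open>q\<close> lying in the square of side \<open>2 * pi\<close> centred at \<open>p\<close>. On that square Jordan's inequality
  \<open>2 / pi * \<bar>t\<bar> \<le> \<bar>sin t\<bar>\<close> turns \<open>phi\<close> into an upper bound for the squared distance, and chaining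
  steps of length \<open>\<delta>\<close> gives
  \<open>dist (f q) (f p) \<le> (1 + pi\<^sup>2 * phi p q / \<delta>\<^sup>2) * \<omega>(f; \<delta>)\<close> for every \<open>\<delta> > 0\<close>.
  Endpoints at a fixed level satisfy the same estimate, so applying the positive operator to it
  with \<open>\<delta> = \<gamma>\<close> bounds \<open>dist (T f p) (f p)\<close> uniformly. If \<open>\<gamma> = 0\<close>, the operator
  annihilates \<open>phi p\<close> at \<open>p\<close>, and continuity of \<open>f\<close> at \<open>p\<close> alone makes the modulus term vanish.\<close>

section \<open>Distances modulo periods\<close>

text \<open>On \<open>{0..pi/2}\<close> the sine is concave, so it lies above the chord joining its
  values at the two ends. Negative arguments follow because sine is odd.\<close>

lemma jordan_sin:
  fixes x :: real
  assumes "\<bar>x\<bar> \<le> pi / 2"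
  shows "2 / pi * \<bar>x\<bar> \<le> \<bar>sin x\<bar>"
proof -
  have *: "2 / pi * y \<le> sin y" if y: "0 \<le> y" "y \<le> pi / 2" for y
  proof -
    have "concave_on {0..pi/2} sin"
    proof (rule f''_le0_imp_concave)
      show "((\<lambda>x::real. cos x) has_real_derivative - sin x) (at x)" for x
        by (auto intro!: derivative_eq_intros)
      show "- sin x \<le> 0" if "x \<in> {0..pi/2}" for x
        using that by (auto intro!: sin_ge_zero)
    qed (auto intro!: derivative_eq_intros)
    \<comment> \<open>The point \<open>y\<close> is the convex combination of \<open>0\<close> and
      \<open>pi / 2\<close> with weight \<open>2 * y / pi\<close> on the right end, where the sine
      is 1.\<close>
    from concave_onD[OF this, of "2 * y / pi" 0 "pi / 2"] y
    show ?thesis by simp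
  qed
  show ?thesis
    using *[of "\<bar>x\<bar>"] assms sin_ge_zero[of "\<bar>x\<bar>"] by (cases "x \<ge> 0") auto
qed

text \<open>Measured in units of \<open>2 * pi\<close>, the offset \<open>x - u\<close> differs from
  its nearest integer by at most 1/2. Subtracting that integer gives the translate, hence the minus
  sign before \<open>round\<close>.\<close>

lemma period_representative:
  fixes x u :: real
  obtains n :: int where "\<bar>x + 2 * of_int n * pi - u\<bar> \<le> pi"
proof
  let ?r = "(x - u) / (2 * pi)"
  have "\<bar>of_int (round ?r) - ?r\<bar> * (2 * pi) \<le> 1 / 2 * (2 * pi)"
    by (intro mult_right_mono of_int_round_abs_le) auto
  also have "\<bar>of_int (round ?r) - ?r\<bar> * (2 * pi) = \<bar>(of_int (round ?r) - ?r) * (2 * pi)\<bar>"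
    by (simp add: abs_mult)
  also have "(of_int (round ?r) - ?r) * (2 * pi) = - (x + 2 * of_int (- round ?r) * pi - u)"
    by (simp add: field_simps)
  finally show "\<bar>x + 2 * of_int (- round ?r) * pi - u\<bar> \<le> pi" by simp
qed

lemma periodic_2pi_shift:
  assumes "periodic_2pi f"
  shows "f (x + 2 * of_int n * pi, y + 2 * of_int m * pi) = f (x, y)"
  using assms unfolding periodic_2pi_def by metis

text \<open>A full period moves the half angle by a multiple of \<open>pi\<close>, which can only
  change the sign of the sine; the square removes the sign.\<close>

lemma periodic_2pi_phi: "periodic_2pi (phi u v)"
proof -
  have "(sin ((x + 2 * of_int n * pi - u) / 2))\<^sup>2 = (sin ((x - u) / 2))\<^sup>2" for x u and n :: int
  proof -
    have "(x + 2 * of_int n * pi - u) / 2 = (x - u) / 2 + pi * of_int n" by (simp add: field_simps)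
    moreover have "(sin (t + pi * of_int n))\<^sup>2 = (sin t)\<^sup>2" for t
      by (simp add: sin_add)
    ultimately show ?thesis by (simp only:)
  qed
  then show ?thesis by (simp add: periodic_2pi_def phi_def)
qed

lemma phi_in_C2pi: "phi u v \<in> C2pi"
  using periodic_2pi_phi by (auto simp: C2pi_def phi_def case_prod_unfold intro!: continuous_intros)

lemma phi_nonneg: "0 \<le> phi u v q"
  by (auto simp: phi_def case_prod_unfold)

lemma phi_le_2: "phi u v q \<le> 2"
proof -
  have "(sin t)\<^sup>2 \<le> 1" for t :: real by (simp add: abs_square_le_1)
  from add_mono[OF this this] show ?thesis by (simp add: phi_def case_prod_unfold)
qed

lemma dist_le_phi_near:
  assumes "\<bar>x - u\<bar> \<le> pi" "\<bar>y - v\<bar> \<le> pi"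
  shows "(dist (x, y) (u, v))\<^sup>2 \<le> pi\<^sup>2 * phi u v (x, y)"
proof -
  have *: "t\<^sup>2 \<le> pi\<^sup>2 * (sin (t / 2))\<^sup>2" if "\<bar>t\<bar> \<le> pi" for t
  proof -
    have "\<bar>t\<bar> \<le> pi * \<bar>sin (t / 2)\<bar>"
      using jordan_sin[of "t / 2"] that by (simp add: field_simps)
    then have "\<bar>t\<bar>\<^sup>2 \<le> (pi * \<bar>sin (t / 2)\<bar>)\<^sup>2" by (intro power_mono) auto
    then show ?thesis by (simp add: power_mult_distrib)
  qed
  show ?thesis
    using *[OF assms(1)] *[OF assms(2)] by (simp add: phi_def dist_Pair_Pair dist_real_def algebra_simps)
qed

text \<open>One translate \<open>q'\<close> serves \<open>phi u v\<close> and \<open>f\<close>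
  simultaneously, so an estimate valid only near \<open>(u, v)\<close> can be stated at the original
  point \<open>q\<close>.\<close>

lemma phi_representative:
  obtains q' where "(dist q' (u, v))\<^sup>2 \<le> pi\<^sup>2 * phi u v q" "\<And>f. periodic_2pi f \<Longrightarrow> f q' = f q"
proof -
  obtain x y where q: "q = (x, y)" by fastforce
  obtain n where n: "\<bar>x + 2 * of_int n * pi - u\<bar> \<le> pi" by (rule period_representative)
  obtain m where m: "\<bar>y + 2 * of_int m * pi - v\<bar> \<le> pi" by (rule period_representative)
  show thesis
  proof
    show "(dist (x + 2 * of_int n * pi, y + 2 * of_int m * pi) (u, v))\<^sup>2 \<le> pi\<^sup>2 * phi u v q"
      using dist_le_phi_near[OF n m] periodic_2pi_shift[OF periodic_2pi_phi] by (simp add: q)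
  qed (simp add: q periodic_2pi_shift)
qed

text \<open>Periodicity makes the whole range the image of one compact square. This boundedness is
  what makes the real suprema below meaningful.\<close>

lemma bounded_range_periodic:
  fixes f :: "real \<times> real \<Rightarrow> 'a :: metric_space"
  assumes "periodic_2pi f" "continuous_on UNIV f"
  shows "bounded (range f)"
proof -
  have "range f \<subseteq> f ` ({-pi..pi} \<times> {-pi..pi})"
  proof (intro image_subsetI)
    fix q :: "real \<times> real"
    obtain x y where q: "q = (x, y)" by fastforce
    obtain n where n: "\<bar>x + 2 * of_int n * pi - 0\<bar> \<le> pi" by (rule period_representative)
    obtain m where m: "\<bar>y + 2 * of_int m * pi - 0\<bar> \<le> pi" by (rule period_representative)
    have "f q = f (x + 2 * of_int n * pi, y + 2 * of_int m * pi)"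
      by (simp add: q periodic_2pi_shift[OF assms(1)])
    then show "f q \<in> f ` ({-pi..pi} \<times> {-pi..pi})" using n m by (intro image_eqI) auto
  qed
  moreover have "bounded (f ` ({-pi..pi} \<times> {-pi..pi}))"
    by (intro compact_imp_bounded compact_continuous_image compact_Times compact_Icc
        continuous_on_subset[OF assms(2)]) auto
  ultimately show ?thesis by (rule bounded_subset[rotated])
qed

lemma le_sup_norm:
  assumes "g \<in> C2pi"
  shows "\<bar>g p\<bar> \<le> sup_norm g"
proof -
  have "bounded (range g)" using assms by (intro bounded_range_periodic) (auto simp: C2pi_def)
  then obtain B where "\<And>q. \<bar>g q\<bar> \<le> B" by (auto simp: bounded_iff)
  then show ?thesis unfolding sup_norm_def by (intro cSUP_upper) (auto intro!: bdd_aboveI)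
qed

section \<open>The metric on fuzzy numbers\<close>

lemma fuzzy_dist_leI:
  assumes "\<And>\<alpha>. \<alpha> \<in> {0..1} \<Longrightarrow> \<bar>lower_end \<mu> \<alpha> - lower_end \<eta> \<alpha>\<bar> \<le> M"
    and "\<And>\<alpha>. \<alpha> \<in> {0..1} \<Longrightarrow> \<bar>upper_end \<mu> \<alpha> - upper_end \<eta> \<alpha>\<bar> \<le> M"
  shows "dist \<mu> \<eta> \<le> M"
  unfolding dist_fuzzy_def using assms by (intro cSUP_least) auto

lemma ends_dist_le:
  assumes "\<alpha> \<in> {0..1}"
  shows "\<bar>lower_end \<mu> \<alpha> - lower_end \<eta> \<alpha>\<bar> \<le> dist \<mu> \<eta>"
    and "\<bar>upper_end \<mu> \<alpha> - upper_end \<eta> \<alpha>\<bar> \<le> dist \<mu> \<eta>"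
  using cSUP_upper[OF assms bdd_above_end_diff[of \<mu> \<eta>]]
  by (auto simp: dist_fuzzy_def end_diff_def)

text \<open>Scaling by 0 collapses every level to \<open>{0}\<close>. The result is the crisp number
  0, and the distance to it bounds the endpoints at all levels at once.\<close>

lemma ends_scaleR_0:
  assumes "\<alpha> \<in> {0..1}"
  shows "lower_end (0 *\<^sub>R \<mu>) \<alpha> = 0" "upper_end (0 *\<^sub>R \<mu>) \<alpha> = 0"
proof -
  have "level (0 *\<^sub>R \<mu>) \<alpha> = {0}"
    using level_nonempty[OF assms, of \<mu>] by (auto simp: level_scaleR[OF assms])
  then show "lower_end (0 *\<^sub>R \<mu>) \<alpha> = 0" "upper_end (0 *\<^sub>R \<mu>) \<alpha> = 0"
    by (simp_all add: lower_end_def upper_end_def)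
qed

text \<open>Transfers continuity from a fuzzy-valued function to its endpoint functions, whose
  increments are dominated by the metric.\<close>

lemma continuous_on_dist_le:
  fixes f :: "'a :: metric_space \<Rightarrow> 'b :: metric_space" and g :: "'a \<Rightarrow> 'c :: metric_space"
  assumes "continuous_on S f" "\<And>x y. dist (g x) (g y) \<le> dist (f x) (f y)"
  shows "continuous_on S g"
  using assms unfolding continuous_on_iff by (meson le_less_trans)

lemma ends_in_C2pi:
  assumes "f \<in> C2pi_F" "\<alpha> \<in> {0..1}"
  shows "(\<lambda>p. lower_end (f p) \<alpha>) \<in> C2pi" "(\<lambda>p. upper_end (f p) \<alpha>) \<in> C2pi"
proof -
  have p: "periodic_2pi f" and c: "continuous_on UNIV f" using assms by (auto simp: C2pi_F_def)
  have "periodic_2pi (\<lambda>p. lower_end (f p) \<alpha>)" "periodic_2pi (\<lambda>p. upper_end (f p) \<alpha>)"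
    using p unfolding periodic_2pi_def by metis+
  then show "(\<lambda>p. lower_end (f p) \<alpha>) \<in> C2pi" "(\<lambda>p. upper_end (f p) \<alpha>) \<in> C2pi"
    using ends_dist_le[OF assms(2)]
    by (auto simp: C2pi_def dist_real_def intro!: continuous_on_dist_le[OF c])
qed

lemma C2pi_F_bounded:
  assumes "f \<in> C2pi_F"
  obtains M where "\<And>p. dist (f p) \<mu> \<le> M"
proof -
  have "bounded (range f)" using assms by (intro bounded_range_periodic) (auto simp: C2pi_F_def)
  then obtain M where "\<And>p. dist \<mu> (f p) \<le> M" by (auto simp: bounded_any_center[of _ \<mu>])
  then show thesis using that by (metis dist_commute)
qed

lemma C2pi_F_dist_bounded:
  assumes "f \<in> C2pi_F"
  obtains M where "\<And>p q. dist (f p) (f q) \<le> M"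
proof -
  obtain M where M: "\<And>p. dist (f p) (f 0) \<le> M" using C2pi_F_bounded[OF assms] by blast
  have "dist (f p) (f q) \<le> M + M" for p q
    using dist_triangle2[of "f p" "f q" "f 0"] M[of p] M[of q] by linarith
  then show thesis using that by blast
qed

lemma C2pi_F_ends_bounded:
  assumes "f \<in> C2pi_F"
  obtains M where "\<And>p \<alpha>. \<alpha> \<in> {0..1} \<Longrightarrow> \<bar>lower_end (f p) \<alpha>\<bar> \<le> M"
    and "\<And>p \<alpha>. \<alpha> \<in> {0..1} \<Longrightarrow> \<bar>upper_end (f p) \<alpha>\<bar> \<le> M"
proof -
  let ?z = "0 *\<^sub>R f 0"
  obtain M where M: "\<And>p. dist (f p) ?z \<le> M" using C2pi_F_bounded[OF assms] by blast
  have "\<bar>lower_end (f p) \<alpha>\<bar> \<le> M" "\<bar>upper_end (f p) \<alpha>\<bar> \<le> M" if "\<alpha> \<in> {0..1}" for p \<alpha>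
    using ends_dist_le[OF that, of "f p" ?z] ends_scaleR_0[OF that, of "f 0"] M[of p] by simp_all
  then show thesis using that by blast
qed

section \<open>The modulus of continuity\<close>

lemma dist_le_fuzzy_modulus:
  assumes "f \<in> C2pi_F" "dist p q \<le> \<delta>"
  shows "dist (f p) (f q) \<le> fuzzy_modulus f \<delta>"
proof -
  obtain M where M: "\<And>p q. dist (f p) (f q) \<le> M" using C2pi_F_dist_bounded[OF assms(1)] by blast
  show ?thesis unfolding fuzzy_modulus_def
  proof (rule cSup_upper)
    show "dist (f p) (f q) \<in> {dist (f (u, v)) (f (x, y)) | u v x y. sqrt ((u - x)\<^sup>2 + (v - y)\<^sup>2) \<le> \<delta>}"
      using assms(2) by (cases p; cases q) (auto simp: dist_Pair_Pair dist_real_def)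
    show "bdd_above {dist (f (u, v)) (f (x, y)) | u v x y. sqrt ((u - x)\<^sup>2 + (v - y)\<^sup>2) \<le> \<delta>}"
      using M by (auto intro!: bdd_aboveI)
  qed
qed

text \<open>The segment from \<open>p\<close> to \<open>q\<close> is cut into equal steps of length
  at most \<open>\<delta>\<close>, each costing at most \<open>w\<close>; the induction splits off
  the last step.\<close>

lemma dist_image_chain:
  fixes f :: "'a :: real_normed_vector \<Rightarrow> 'b :: metric_space"
  assumes step: "\<And>p q. dist p q \<le> \<delta> \<Longrightarrow> dist (f p) (f q) \<le> w" and "dist p q \<le> real n * \<delta>"
  shows "dist (f p) (f q) \<le> real n * w"
  using assms(2)
proof (induction n arbitrary: q)
  case 0
  then show ?case by simp
next
  case (Suc n)
  \<comment> \<open>With \<open>n + 1\<close> equal steps, \<open>r\<close> is the last division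
    point before \<open>q\<close>.\<close>
  define r where "r = p + (real n / (real n + 1)) *\<^sub>R (q - p)"
  have "r - p = (real n / (real n + 1)) *\<^sub>R (q - p)" by (simp add: r_def)
  then have "norm (r - p) = real n / (real n + 1) * norm (q - p)" by simp
  also have "\<dots> \<le> real n / (real n + 1) * ((real n + 1) * \<delta>)"
    using Suc.prems by (intro mult_left_mono) (auto simp: dist_norm norm_minus_commute algebra_simps)
  finally have "dist p r \<le> real n * \<delta>" by (simp add: dist_norm norm_minus_commute)
  then have 1: "dist (f p) (f r) \<le> real n * w" by (rule Suc.IH)
  have "1 - real n / (real n + 1) = 1 / (real n + 1)" by (simp add: field_simps)
  moreover have "q - r = (1 - real n / (real n + 1)) *\<^sub>R (q - p)"
    by (simp add: r_def algebra_simps)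
  ultimately have "q - r = (1 / (real n + 1)) *\<^sub>R (q - p)" by simp
  then have "norm (q - r) = 1 / (real n + 1) * norm (q - p)" by simp
  also have "\<dots> \<le> 1 / (real n + 1) * ((real n + 1) * \<delta>)"
    using Suc.prems by (intro mult_left_mono) (auto simp: dist_norm norm_minus_commute algebra_simps)
  finally have "dist r q \<le> \<delta>" by (simp add: dist_norm norm_minus_commute)
  then have "dist (f r) (f q) \<le> w" by (rule step)
  with 1 show ?case using dist_triangle[of "f p" "f q" "f r"] by (simp add: algebra_simps)
qed

text \<open>Chaining costs about \<open>1 + ?r\<close> moduli. Beyond distance
  \<open>\<delta>\<close> the ratio \<open>?r\<close> is at least 1, so it may be replaced by its
  square, which is the quantity that \<open>phi\<close> controls.\<close>

lemma dist_le_modulus_quadratic: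
  assumes f: "f \<in> C2pi_F" and \<delta>: "0 < \<delta>"
  shows "dist (f p) (f q) \<le> (1 + (dist p q)\<^sup>2 / \<delta>\<^sup>2) * fuzzy_modulus f \<delta>"
proof -
  let ?w = "fuzzy_modulus f \<delta>" and ?r = "dist p q / \<delta>"
  have w: "dist (f x) (f y) \<le> ?w" if "dist x y \<le> \<delta>" for x y
    using dist_le_fuzzy_modulus[OF f that] .
  have w0: "0 \<le> ?w" using w[of 0 0] \<delta> by simp
  show ?thesis
  proof (cases "dist p q \<le> \<delta>")
    case True
    have "dist (f p) (f q) \<le> 1 * ?w" using w[OF True] by simp
    also have "\<dots> \<le> (1 + (dist p q)\<^sup>2 / \<delta>\<^sup>2) * ?w" using w0 by (intro mult_right_mono) auto
    finally show ?thesis .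
  next
    case False
    define n where "n = nat \<lceil>?r\<rceil>"
    have r: "1 \<le> ?r" using False \<delta> by simp
    have "0 \<le> \<lceil>?r\<rceil>" using r by linarith
    then have "real n = of_int \<lceil>?r\<rceil>" by (simp add: n_def)
    then have n: "?r \<le> real n" "real n \<le> 1 + ?r" by linarith+
    have "dist p q \<le> real n * \<delta>" using n(1) \<delta> by (simp add: field_simps)
    then have "dist (f p) (f q) \<le> real n * ?w" by (rule dist_image_chain[rotated]) (rule w)
    also have "\<dots> \<le> (1 + ?r\<^sup>2) * ?w"
      using n(2) r w0 self_le_power[of ?r 2] by (intro mult_right_mono) auto
    finally show ?thesis by (simp add: power_divide)
  qed
qed

lemma dist_le_modulus_phi:
  assumes f: "f \<in> C2pi_F" and \<delta>: "0 < \<delta>"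
  shows "dist (f q) (f (u, v))
    \<le> fuzzy_modulus f \<delta> + pi\<^sup>2 * fuzzy_modulus f \<delta> / \<delta>\<^sup>2 * phi u v q"
proof -
  let ?w = "fuzzy_modulus f \<delta>"
  obtain q' where q': "(dist q' (u, v))\<^sup>2 \<le> pi\<^sup>2 * phi u v q" "f q' = f q"
    using phi_representative[of u v q] f unfolding C2pi_F_def by blast
  have w0: "0 \<le> ?w" using dist_le_fuzzy_modulus[OF f, of 0 0 \<delta>] \<delta> by simp
  have "dist (f q) (f (u, v)) \<le> (1 + (dist q' (u, v))\<^sup>2 / \<delta>\<^sup>2) * ?w"
    using dist_le_modulus_quadratic[OF f \<delta>, of q' "(u, v)"] q'(2) by simp
  also have "\<dots> \<le> (1 + (pi\<^sup>2 * phi u v q) / \<delta>\<^sup>2) * ?w"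
    using q'(1) w0 by (intro mult_right_mono add_left_mono divide_right_mono) auto
  finally show ?thesis by (simp add: algebra_simps)
qed

text \<open>A substitute for the modulus estimate when no positive \<open>\<delta>\<close> is
  available. Continuity at \<open>(u, v)\<close> handles nearby representatives; elsewhere
  \<open>phi u v\<close> is bounded away from 0, so a large multiple of it dominates the bounded
  oscillation of \<open>f\<close>.\<close>

lemma dist_le_eps_phi:
  assumes f: "f \<in> C2pi_F" and e: "0 < e"
  obtains C where "0 \<le> C" "\<And>q. dist (f q) (f (u, v)) \<le> e + C * phi u v q"
proof -
  have per: "periodic_2pi f" and "continuous_on UNIV f" using f by (auto simp: C2pi_F_def)
  then obtain d where d: "d > 0" "\<And>q. dist q (u, v) < d \<Longrightarrow> dist (f q) (f (u, v)) < e"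
    using e unfolding continuous_on_iff by (metis UNIV_I)
  obtain M where M: "\<And>p q. dist (f p) (f q) \<le> M" using C2pi_F_dist_bounded[OF f] by blast
  have M0: "0 \<le> M" using M[of 0 0] by simp
  show thesis
  proof
    \<comment> \<open>The witness is the global oscillation bound \<open>M\<close> divided by
      \<open>d\<^sup>2 / pi\<^sup>2\<close>, the least value that \<open>phi u v\<close> can take
      once the representative is at distance \<open>d\<close> or more.\<close>
    show "0 \<le> M * pi\<^sup>2 / d\<^sup>2" using M0 by simp
    fix q
    obtain q' where q': "(dist q' (u, v))\<^sup>2 \<le> pi\<^sup>2 * phi u v q" "f q' = f q"
      using phi_representative[of u v q] per by blast
    show "dist (f q) (f (u, v)) \<le> e + M * pi\<^sup>2 / d\<^sup>2 * phi u v q"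
    proof (cases "dist q' (u, v) < d")
      case True
      then have "dist (f q) (f (u, v)) \<le> e" using d(2) q'(2) by fastforce
      moreover have "0 \<le> M * pi\<^sup>2 / d\<^sup>2 * phi u v q" using M0 phi_nonneg by simp
      ultimately show ?thesis by linarith
    next
      case False
      then have "d\<^sup>2 \<le> (dist q' (u, v))\<^sup>2" using d(1) by (intro power_mono) auto
      also note q'(1)
      finally have "1 \<le> pi\<^sup>2 * phi u v q / d\<^sup>2" using d(1) by (simp add: le_divide_eq)
      then have "M * 1 \<le> M * (pi\<^sup>2 * phi u v q / d\<^sup>2)" using M0 by (rule mult_left_mono)
      then show ?thesis using M[of q "(u, v)"] e by (simp add: mult.assoc)
    qed
  qed
qed

section \<open>Positive operators\<close>

lemma const_in_C2pi: "(\<lambda>_. c) \<in> C2pi"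
  by (auto simp: C2pi_def periodic_2pi_def)

lemma C2pi_lincomb:
  assumes "g \<in> C2pi" "h \<in> C2pi"
  shows "(\<lambda>q. a * g q + b * h q) \<in> C2pi"
proof -
  have "periodic_2pi (\<lambda>q. a * g q + b * h q)"
    using assms unfolding C2pi_def periodic_2pi_def mem_Collect_eq by metis
  then show ?thesis using assms by (auto simp: C2pi_def intro!: continuous_intros)
qed

lemma positive_linear_lincomb:
  assumes "positive_linear L" "g \<in> C2pi" "h \<in> C2pi"
  shows "L (\<lambda>q. a * g q + b * h q) p = a * L g p + b * L h p"
  using assms unfolding positive_linear_def by blast

lemma positive_linear_in_C2pi:
  assumes "positive_linear L" "g \<in> C2pi"
  shows "L g \<in> C2pi"
  using assms unfolding positive_linear_def by blast

lemma positive_linear_nonneg: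
  assumes "positive_linear L" "g \<in> C2pi" "\<And>q. 0 \<le> g q"
  shows "0 \<le> L g p"
  using assms unfolding positive_linear_def by blast

lemma positive_linear_mono:
  assumes L: "positive_linear L" and g: "g \<in> C2pi" and h: "h \<in> C2pi" and le: "\<And>q. g q \<le> h q"
  shows "L g p \<le> L h p"
proof -
  have "0 \<le> L (\<lambda>q. 1 * h q + (-1) * g q) p"
    using le by (intro positive_linear_nonneg[OF L C2pi_lincomb[OF h g]]) simp
  then show ?thesis unfolding positive_linear_lincomb[OF L h g] by simp
qed

text \<open>Monotonicity is applied to each of the two one-sided inequalities, and linearity
  evaluates both sides. Since \<open>L\<close> need not preserve constants, the values of
  \<open>L (\<lambda>_. 1)\<close> remain.\<close>

lemma positive_linear_estimate:
  assumes L: "positive_linear L" and g: "g \<in> C2pi" and k: "k \<in> C2pi"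
    and le: "\<And>q. \<bar>g q - c\<bar> \<le> a + b * k q"
  shows "\<bar>L g p - c * L (\<lambda>_. 1) p\<bar> \<le> a * L (\<lambda>_. 1) p + b * L k p"
proof -
  note one = const_in_C2pi[of 1]
  have "L (\<lambda>q. 1 * g q + (- c) * 1) p \<le> L (\<lambda>q. a * 1 + b * k q) p"
    using le by (intro positive_linear_mono[OF L] C2pi_lincomb g k one) (simp add: abs_le_iff)
  moreover have "L (\<lambda>q. (- 1) * g q + c * 1) p \<le> L (\<lambda>q. a * 1 + b * k q) p"
    using le by (intro positive_linear_mono[OF L] C2pi_lincomb g k one) (simp add: abs_le_iff)
  ultimately show ?thesis
    unfolding positive_linear_lincomb[OF L g one] positive_linear_lincomb[OF L one k]
    by (simp add: abs_le_iff)
qed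

text \<open>The supremum bounds its members only if they are bounded above. This follows from
  \<open>phi u v q \<le> 2\<close>, which makes every moment at most twice the norm of
  \<open>L (\<lambda>_. 1)\<close>.\<close>

lemma phi_moment_le_SUP:
  assumes L: "positive_linear L"
  shows "L (phi u v) (u, v) \<le> (SUP (u, v). \<bar>L (phi u v) (u, v)\<bar>)"
proof -
  note one = const_in_C2pi[of 1]
  have "\<bar>L (phi u v) (u, v)\<bar> \<le> 2 * sup_norm (L (\<lambda>_. 1))" for u v
  proof -
    \<comment> \<open>The constant 2 is written as a linear combination so that the linearity rule
      matches.\<close>
    have "L (phi u v) (u, v) \<le> L (\<lambda>q. 2 * 1 + 0 * 1) (u, v)"
      by (intro positive_linear_mono[OF L] phi_in_C2pi const_in_C2pi) (simp add: phi_le_2)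
    also have "\<dots> = 2 * L (\<lambda>_. 1) (u, v)"
      unfolding positive_linear_lincomb[OF L one one] by simp
    also have "\<dots> \<le> 2 * sup_norm (L (\<lambda>_. 1))"
      using le_sup_norm[OF positive_linear_in_C2pi[OF L one], of "(u, v)"] by simp
    finally show ?thesis using positive_linear_nonneg[OF L phi_in_C2pi phi_nonneg] by simp
  qed
  then have "bdd_above (range (\<lambda>(u, v). \<bar>L (phi u v) (u, v)\<bar>))"
    by (intro bdd_aboveI[of _ "2 * sup_norm (L (\<lambda>_. 1))"]) auto
  then have "(\<lambda>(u, v). \<bar>L (phi u v) (u, v)\<bar>) (u, v) \<le> (SUP (u, v). \<bar>L (phi u v) (u, v)\<bar>)"
    by (rule cSUP_upper[OF UNIV_I])
  then show ?thesis by simp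
qed

text \<open>The error splits into \<open>L g p - g p * L (\<lambda>_. 1) p\<close>, controlled by
  the modulus, and \<open>g p * (L (\<lambda>_. 1) p - 1)\<close>, controlled by
  \<open>M * s\<close>. Here \<open>g\<close> stands for a lower or upper endpoint function at a
  fixed level; the bound depends on neither the level nor \<open>p\<close>.\<close>

lemma endpoint_estimate:
  assumes L: "positive_linear L" and f: "f \<in> C2pi_F"
    and \<gamma>: "\<gamma> = sqrt (SUP (u, v). \<bar>L (phi u v) (u, v)\<bar>)"
    and g: "g \<in> C2pi" and gf: "\<And>p q. \<bar>g p - g q\<bar> \<le> dist (f p) (f q)"
    and M: "\<And>q. \<bar>g q\<bar> \<le> M"
    and s: "s = sup_norm (\<lambda>q. L (\<lambda>_. 1) q - 1)"
  shows "\<bar>L g p - g p\<bar> \<le> (1 + s + pi\<^sup>2) * fuzzy_modulus f \<gamma> + M * s"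
proof -
  obtain u v where p: "p = (u, v)" by fastforce
  let ?w = "fuzzy_modulus f \<gamma>" and ?one = "L (\<lambda>_. 1) p" and ?phi = "L (phi u v) p"
  note one = const_in_C2pi[of 1]
  have "(\<lambda>q. 1 * L (\<lambda>_. 1) q + (-1) * 1) \<in> C2pi"
    by (intro C2pi_lincomb one positive_linear_in_C2pi[OF L])
  from le_sup_norm[OF this, of p] have s1: "\<bar>?one - 1\<bar> \<le> s" by (simp add: s)
  have phi0: "0 \<le> ?phi" by (intro positive_linear_nonneg[OF L] phi_in_C2pi phi_nonneg)
  have one0: "0 \<le> ?one" by (intro positive_linear_nonneg[OF L] one) simp
  have sup: "?phi \<le> (SUP (u, v). \<bar>L (phi u v) (u, v)\<bar>)"
    using phi_moment_le_SUP[OF L] by (simp add: p)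
  then have \<gamma>2: "?phi \<le> \<gamma>\<^sup>2" and \<gamma>0: "0 \<le> \<gamma>" using phi0 by (simp_all add: \<gamma>)
  have w0: "0 \<le> ?w" using dist_le_fuzzy_modulus[OF f, of 0 0 \<gamma>] \<gamma>0 by simp
  have main: "\<bar>L g p - g p * ?one\<bar> \<le> (1 + s + pi\<^sup>2) * ?w"
  proof (cases "\<gamma> = 0")
    case False
    have "\<bar>L g p - g p * ?one\<bar> \<le> ?w * ?one + pi\<^sup>2 * ?w / \<gamma>\<^sup>2 * ?phi"
      using False \<gamma>0 unfolding p
      by (intro positive_linear_estimate[OF L g phi_in_C2pi] order_trans[OF gf]
          dist_le_modulus_phi[OF f]) auto
    \<comment> \<open>Taking \<open>\<delta> = \<gamma>\<close> pays off here: the moment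
      \<open>?phi\<close> is at most \<open>\<gamma>\<^sup>2\<close>, which cancels the
      denominator.\<close>
    also have "\<dots> \<le> ?w * (1 + s) + pi\<^sup>2 * ?w / \<gamma>\<^sup>2 * \<gamma>\<^sup>2"
      using s1 w0 \<gamma>2 by (intro add_mono mult_left_mono) auto
    finally show ?thesis using False by (simp add: algebra_simps)
  next
    case True
    have *: "\<bar>L g p - g p * ?one\<bar> \<le> e * ?one" if e: "0 < e" for e
    proof -
      obtain C where "\<And>q. dist (f q) (f (u, v)) \<le> e + C * phi u v q"
        using dist_le_eps_phi[OF f e] by metis
      then have "\<bar>L g p - g p * ?one\<bar> \<le> e * ?one + C * ?phi" unfolding p
        by (intro positive_linear_estimate[OF L g phi_in_C2pi] order_trans[OF gf])
      \<comment> \<open>Here \<open>?phi\<close> vanishes, so the size of \<open>C\<close>, which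
        may depend on \<open>e\<close> and on the point, does not matter.\<close>
      then show ?thesis using \<gamma>2 phi0 True by simp
    qed
    have "\<bar>L g p - g p * ?one\<bar> \<le> 0 + e" if e: "0 < e" for e
    proof -
      \<comment> \<open>Dividing by \<open>1 + ?one\<close> keeps the denominator positive even when
        \<open>?one\<close> is 0.\<close>
      have "\<bar>L g p - g p * ?one\<bar> \<le> e / (1 + ?one) * ?one" using e one0 by (intro *) simp
      also have "\<dots> \<le> e" using e one0 by (simp add: field_simps)
      finally show ?thesis by simp
    qed
    then have "\<bar>L g p - g p * ?one\<bar> \<le> 0" by (rule field_le_epsilon)
    also have "0 \<le> (1 + s + pi\<^sup>2) * ?w" using s1 w0 by (intro mult_nonneg_nonneg) auto
    finally show ?thesis .
  qed
  have "\<bar>g p * (?one - 1)\<bar> \<le> M * s"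
    unfolding abs_mult using M[of p] s1 by (intro mult_mono) auto
  with main show ?thesis by (simp add: algebra_simps abs_le_iff)
qed

section \<open>Convergence in \<open>Dstar\<close>: a uniform error bound and the Pringsheim
  limit\<close>

theorem theorem2p2:
  fixes T :: "nat \<Rightarrow> nat \<Rightarrow> (real \<times> real \<Rightarrow> fuzzy) \<Rightarrow> (real \<times> real \<Rightarrow> fuzzy)"
    and T' :: "nat \<Rightarrow> nat \<Rightarrow> (real \<times> real \<Rightarrow> real) \<Rightarrow> (real \<times> real \<Rightarrow> real)"
    and \<gamma> :: "nat \<Rightarrow> nat \<Rightarrow> real"
    and f :: "real \<times> real \<Rightarrow> fuzzy"
  assumes "\<And>m n. fuzzy_positive_linear (T m n)"
    and "\<And>m n. positive_linear (T' m n)"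
    and "\<And>m n u v \<alpha> g. \<alpha> \<in> {0..1} \<Longrightarrow> g \<in> C2pi_F \<Longrightarrow>
           lower_end (T m n g (u, v)) \<alpha> = T' m n (\<lambda>p. lower_end (g p) \<alpha>) (u, v) \<and>
           upper_end (T m n g (u, v)) \<alpha> = T' m n (\<lambda>p. upper_end (g p) \<alpha>) (u, v)"
    and "\<And>m n. \<gamma> m n = sqrt (SUP (u, v). \<bar>T' m n (phi u v) (u, v)\<bar>)"
    and "f \<in> C2pi_F"
    and "pringsheim_lim (\<lambda>m n. sup_norm (\<lambda>p. T' m n (\<lambda>_. 1) p - 1)) 0"
    and "pringsheim_lim (\<lambda>m n. fuzzy_modulus f (\<gamma> m n)) 0"
  shows "pringsheim_lim (\<lambda>m n. Dstar (T m n f) f) 0"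
proof -
  note L = assms(2) and ends = assms(3) and f = assms(5)
  obtain M where M: "\<And>p \<alpha>. \<alpha> \<in> {0..1} \<Longrightarrow> \<bar>lower_end (f p) \<alpha>\<bar> \<le> M"
    "\<And>p \<alpha>. \<alpha> \<in> {0..1} \<Longrightarrow> \<bar>upper_end (f p) \<alpha>\<bar> \<le> M"
    using C2pi_F_ends_bounded[OF f] by blast
  have M0: "0 \<le> M" using M(1)[of 0 0] by simp
  define s where "s m n = sup_norm (\<lambda>p. T' m n (\<lambda>_. 1) p - 1)" for m n
  define w where "w m n = fuzzy_modulus f (\<gamma> m n)" for m n
  have D: "\<bar>Dstar (T m n f) f\<bar> \<le> (1 + s m n + pi\<^sup>2) * w m n + M * s m n" for m n
  proof -
    let ?B = "(1 + s m n + pi\<^sup>2) * w m n + M * s m n"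
    have le: "dist (T m n f p) (f p) \<le> ?B" for p
    proof (rule fuzzy_dist_leI)
      fix \<alpha> :: real assume \<alpha>: "\<alpha> \<in> {0..1}"
      obtain u v where p: "p = (u, v)" by fastforce
      show "\<bar>lower_end (T m n f p) \<alpha> - lower_end (f p) \<alpha>\<bar> \<le> ?B"
        using endpoint_estimate[OF L f assms(4) ends_in_C2pi(1)[OF f \<alpha>] ends_dist_le(1)[OF \<alpha>]
            M(1)[OF \<alpha>] refl] ends[OF \<alpha> f]
        by (simp add: p s_def w_def)
      show "\<bar>upper_end (T m n f p) \<alpha> - upper_end (f p) \<alpha>\<bar> \<le> ?B"
        using endpoint_estimate[OF L f assms(4) ends_in_C2pi(2)[OF f \<alpha>] ends_dist_le(2)[OF \<alpha>]
            M(2)[OF \<alpha>] refl] ends[OF \<alpha> f]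
        by (simp add: p s_def w_def)
    qed
    have "Dstar (T m n f) f \<le> ?B" unfolding Dstar_def using le by (intro cSUP_least) auto
    \<comment> \<open>The bound \<open>le\<close> also shows that the set of distances is bounded
      above, so its supremum dominates each nonnegative member.\<close>
    moreover have "0 \<le> Dstar (T m n f) f" unfolding Dstar_def
      using le by (intro cSUP_upper2[of _ _ 0] bdd_aboveI[of _ ?B]) auto
    ultimately show ?thesis by simp
  qed
  show ?thesis unfolding pringsheim_lim_def
  proof (intro allI impI)
    fix e :: real assume e: "0 < e"
    \<comment> \<open>Once \<open>\<bar>s m n\<bar> < 1\<close>, the factor
      \<open>1 + s m n + pi\<^sup>2\<close> is below \<open>2 + pi\<^sup>2\<close>; adding the
      coefficient \<open>M\<close> of \<open>s m n\<close> gives \<open>K\<close>. The minimum with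
      1 in \<open>d\<close> secures that condition.\<close>
    define K where "K = 2 + pi\<^sup>2 + M"
    have K: "0 < K" using M0 by (auto simp: K_def intro!: add_pos_nonneg)
    define d where "d = min 1 (e / K)"
    have d: "0 < d" using e K by (simp add: d_def)
    obtain N1 where N1: "\<And>m n. N1 \<le> m \<Longrightarrow> N1 \<le> n \<Longrightarrow> \<bar>s m n\<bar> < d"
      using assms(6) d unfolding pringsheim_lim_def s_def by (metis diff_zero)
    obtain N2 where N2: "\<And>m n. N2 \<le> m \<Longrightarrow> N2 \<le> n \<Longrightarrow> \<bar>w m n\<bar> < d"
      using assms(7) d unfolding pringsheim_lim_def w_def by (metis diff_zero)
    have "\<bar>Dstar (T m n f) f - 0\<bar> < e" if "max N1 N2 \<le> m" "max N1 N2 \<le> n" for m n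
    proof -
      have sd: "\<bar>s m n\<bar> < d" and wd: "\<bar>w m n\<bar> < d" using N1 N2 that by auto
      have "\<bar>Dstar (T m n f) f\<bar> \<le> (1 + s m n + pi\<^sup>2) * w m n + M * s m n" by (rule D)
      also have "\<dots> \<le> (2 + pi\<^sup>2) * \<bar>w m n\<bar> + M * \<bar>s m n\<bar>"
      proof (intro add_mono mult_left_mono M0)
        have "(1 + s m n + pi\<^sup>2) * w m n \<le> \<bar>1 + s m n + pi\<^sup>2\<bar> * \<bar>w m n\<bar>"
          by (metis abs_ge_self abs_mult)
        also have "\<dots> \<le> (2 + pi\<^sup>2) * \<bar>w m n\<bar>"
          using sd zero_le_power2[of pi] by (intro mult_right_mono) (auto simp: d_def)
        finally show "(1 + s m n + pi\<^sup>2) * w m n \<le> (2 + pi\<^sup>2) * \<bar>w m n\<bar>" .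
      qed auto
      \<comment> \<open>Strictness comes from the first summand, because \<open>M\<close> may be
        0.\<close>
      also have "\<dots> < (2 + pi\<^sup>2) * d + M * d"
        using sd wd M0 by (intro add_less_le_mono mult_strict_left_mono mult_left_mono) (auto intro: add_pos_nonneg)
      also have "\<dots> = K * d" by (simp add: K_def algebra_simps)
      also have "\<dots> \<le> e" using K by (simp add: d_def min_def field_simps)
      finally show ?thesis by simp
    qed
    then show "\<exists>N. \<forall>m\<ge>N. \<forall>n\<ge>N. \<bar>Dstar (T m n f) f - 0\<bar> < e" by blast
  qed
qed

end
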